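(* Let $G$ be a graph with $n$ vertices, $m$ edges, and let $\mathcal{M}$ be a circular embedding of $G$ on some orientable surface with $k$ faces. Let $\mathbf{U}=(2\hat{\mathbf{M}}\hat{\mathbf{M}}^T-\mathbf{I}_{2m})(2\hat{\mathbf{N}}\hat{\mathbf{N}}^T-\mathbf{I}_{2m})$ be the transition matrix of the vertex-face walk on $G$ for $\mathcal{M}$. Then, for a complex variable $u$, \[ \det(\mathbf{I}_{2m}-u\mathbf{U})=(1-u)^{2m-n-k}(1+u)^{n-k}\det\big((1+u)^2\mathbf{I}_k-4u\,\hat{\mathbf{M}}^T\hat{\mathbf{N}}\hat{\mathbf{N}}^T\hat{\mathbf{M}}\big). \]
   Context: All graphs are simple (no loops or multiple edges) and connected. For a graph $G$, $D(G)=\{(u,v),(v,u): uv\in E(G)\}$ is the set of $2m$ arcs; for an arc $e=(u,v)$, $o(e)=u$. An embedding is circular if every face is bounded by a cycle. The faces of $\mathcal{M}$ are given a consistent orientation: for each edge $e$ shared by two faces $f,h$, the direction $e$ receives in $f$ is opposite to the direction it receives in $h$; then every arc belongs to exactly one face. $F(G)$ denotes the set of faces. The arc-face incidence matrix $\mathbf{M}=(M_{ef})_{e\in D(G),f\in F(G)}$ has $M_{ef}=1$ if arc $e$ belongs to (the oriented boundary of) face $f$ and $0$ otherwise. The arc-origin incidence matrix $\mathbf{N}=(N_{ev})_{e\in D(G),v\in V(G)}$ has $N_{ev}=1$ if $o(e)=v$ and $0$ otherwise. $\hat{\mathbf{M}}$ and $\hat{\mathbf{N}}$ are the normalized versions of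 $\mathbf{M}$ and $\mathbf{N}$ (each column scaled to unit Euclidean norm), so that $\hat{\mathbf{M}}^T\hat{\mathbf{M}}=\mathbf{I}_k$ and $\hat{\mathbf{N}}^T\hat{\mathbf{N}}=\mathbf{I}_n$. *)

theory Defs
  imports
    Complex_Main
    "HOL-Combinatorics.Orbits"
    "Graph_Theory.Graph_Theory"
    "Jordan_Normal_Form.Determinant"
begin

text \<open>
  Graphs are the finite simple graphs \<^locale>\<open>pair_graph\<close> of the AFP entry
  Graph\_Theory, in which an edge \<open>uv\<close> is the pair of arcs \<open>(u, v)\<close>, \<open>(v, u)\<close>; hence
  \<open>parcs G\<close> is the arc set \<open>D(G)\<close> and \<open>fst\<close> is the origin map \<open>o\<close>.
\<close>

definition edge_set :: "'a pair_pre_digraph \<Rightarrow> 'a set set" where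
  "edge_set G = (\<lambda>(u, v). {u, v}) ` parcs G"

text \<open>
  A cellular embedding of a connected graph on an oriented closed surface is given, up to
  orientation-preserving homeomorphism, by its rotation system: the permutation \<open>\<sigma>\<close> of the arcs
  that cyclically permutes, in the sense of the chosen orientation, the arcs leaving each vertex
  (Heffter, Edmonds). No edge signatures are needed because the surface is orientable.
\<close>

definition rotation_system :: "'a pair_pre_digraph \<Rightarrow> ('a \<times> 'a \<Rightarrow> 'a \<times> 'a) \<Rightarrow> bool" where
  "rotation_system G \<sigma> \<longleftrightarrow>
     \<sigma> permutes parcs G \<and>
     (\<forall>v \<in> pverts G. out_arcs (with_proj G) v \<noteq> {} \<longrightarrow> cyclic_on \<sigma> (out_arcs (with_proj G) v))"

text \<open>
  Face tracing: after the arc \<open>(u, v)\<close>, the boundary of the face continues with the successor of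
  the reversed arc \<open>(v, u)\<close> in the rotation at \<open>v\<close>. This induces the consistent orientation of
  the faces: the two arcs of an edge are traversed by the face on either side of it, so the face
  directions of an edge are opposite and every arc lies on exactly one oriented face boundary.
\<close>

definition face_next :: "('a \<times> 'a \<Rightarrow> 'a \<times> 'a) \<Rightarrow> 'a \<times> 'a \<Rightarrow> 'a \<times> 'a" where
  "face_next \<sigma> e = \<sigma> (snd e, fst e)"

text \<open>
  A face is represented by the set of arcs on its oriented boundary. The one-vertex graph, embedded
  in the sphere, has a single face, whose boundary contains no arc.
\<close>

definition faces :: "'a pair_pre_digraph \<Rightarrow> ('a \<times> 'a \<Rightarrow> 'a \<times> 'a) \<Rightarrow> ('a \<times> 'a) set set" where
  "faces G \<sigma> = (if parcs G = {} then {{}} else orbit (face_next \<sigma>) ` parcs G)"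

text \<open>
  In Graph\_Theory, \<open>cycle\<close> refers to directed cycles and thus admits the walk
  \<open>[(u, v), (v, u)]\<close> along a single edge; the cycles of a simple graph are those of length at
  least 3.
\<close>

definition bounded_by_cycle :: "'a pair_pre_digraph \<Rightarrow> ('a \<times> 'a) set \<Rightarrow> bool" where
  "bounded_by_cycle G f \<longleftrightarrow> (\<exists>p. pre_digraph.cycle (with_proj G) p \<and> 3 \<le> length p \<and> set p = f)"

definition circular_embedding :: "'a pair_pre_digraph \<Rightarrow> ('a \<times> 'a \<Rightarrow> 'a \<times> 'a) \<Rightarrow> bool" where
  "circular_embedding G \<sigma> \<longleftrightarrow>
     rotation_system G \<sigma> \<and> (\<forall>f \<in> faces G \<sigma>. bounded_by_cycle G f)"

text \<open>
  Matrices are indexed by natural numbers, so rows and columns are indexed through enumerations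
  \<open>es\<close>, \<open>fs\<close>, \<open>vs\<close> of the arcs, faces and vertices.
\<close>

definition enumerates :: "'b list \<Rightarrow> 'b set \<Rightarrow> bool" where
  "enumerates xs A \<longleftrightarrow> distinct xs \<and> set xs = A"

definition arc_face_mat :: "('a \<times> 'a) list \<Rightarrow> ('a \<times> 'a) set list \<Rightarrow> complex mat" where
  "arc_face_mat es fs =
     mat (length es) (length fs) (\<lambda>(i, j). if es ! i \<in> fs ! j then 1 else 0)"

definition arc_origin_mat :: "('a \<times> 'a) list \<Rightarrow> 'a list \<Rightarrow> complex mat" where
  "arc_origin_mat es vs =
     mat (length es) (length vs) (\<lambda>(i, j). if fst (es ! i) = vs ! j then 1 else 0)"

definition normalize_cols :: "complex mat \<Rightarrow> complex mat" where
  "normalize_cols A = mat (dim_row A) (dim_col A)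
     (\<lambda>(i, j). A $$ (i, j) / complex_of_real (sqrt (\<Sum>l<dim_row A. (cmod (A $$ (l, j)))\<^sup>2)))"

definition vertex_face_transition :: "complex mat \<Rightarrow> complex mat \<Rightarrow> complex mat" where
  "vertex_face_transition Mh Nh =
     (2 \<cdot>\<^sub>m (Mh * transpose_mat Mh) - 1\<^sub>m (dim_row Mh)) *
     (2 \<cdot>\<^sub>m (Nh * transpose_mat Nh) - 1\<^sub>m (dim_row Nh))"

end

theory Submission
  imports Defs
begin

text \<open>
  Put \<open>A\<close>, \<open>B\<close> for the normalized matrices and \<open>R = 2AA\<^sup>T - I\<close>. Since \<open>R\<close> is an involution,
  \<open>I - uU = R ((u - 1)I + 2AA\<^sup>T - 2uBB\<^sup>T)\<close>, and the second factor is a scalar matrix plus the product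
  of \<open>[A, B]\<close> with the stacked blocks \<open>2A\<^sup>T\<close>, \<open>-2uB\<^sup>T\<close>. Exchanging the two factors of that product
  leaves a determinant of size \<open>k + n\<close>, which a Schur complement reduces to size \<open>k\<close>. This gives the
  identity multiplied by \<open>(1 - u)^(n + k) (1 + u)^k\<close>. The zeros \<open>u = 1\<close> and \<open>u = -1\<close> of this factor
  are recovered by continuity. At \<open>u = 1\<close> this needs \<open>n + k \<le> 2m\<close>: faces have at least two arcs,
  and a vertex of degree one would lie on a face that traverses its edge in both directions.
\<close>

section \<open>Determinants of block matrices with scalar diagonal blocks\<close>

text \<open>Sylvester's determinant identity. The lower left block of \<open>K\<close> is cleared in
  two ways: from the right by \<open>L\<close>, of determinant 1, against the identity block, and
  from the left by \<open>L'\<close>, of determinant \<open>c ^ r\<close>, against the scalar block.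
  No division occurs, so \<open>c = 0\<close> is covered.\<close>

lemma det_scalar_plus_mult_commute:
  fixes X Y :: "'a::idom mat"
  assumes X: "X \<in> carrier_mat N r" and Y: "Y \<in> carrier_mat r N"
  shows "c ^ r * det (c \<cdot>\<^sub>m 1\<^sub>m N + X * Y) = c ^ N * det (c \<cdot>\<^sub>m 1\<^sub>m r + Y * X)"
proof -
  define K where "K = four_block_mat (c \<cdot>\<^sub>m 1\<^sub>m N) (- X) Y (1\<^sub>m r)"
  have K: "K \<in> carrier_mat (N + r) (N + r)"
    unfolding K_def using X Y by auto
  define L where "L = four_block_mat (1\<^sub>m N) (0\<^sub>m N r) (- Y) (1\<^sub>m r)"
  define L' where "L' = four_block_mat (1\<^sub>m N) (0\<^sub>m N r) (- Y) (c \<cdot>\<^sub>m 1\<^sub>m r)"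
  have L: "L \<in> carrier_mat (N + r) (N + r)" and L': "L' \<in> carrier_mat (N + r) (N + r)"
    unfolding L_def L'_def using Y by auto
  have detL: "det L = 1"
    unfolding L_def using Y by (subst det_four_block_mat_upper_right_zero) auto
  have detL': "det L' = c ^ r"
    unfolding L'_def using Y by (subst det_four_block_mat_upper_right_zero) auto
  have "K * L = four_block_mat (c \<cdot>\<^sub>m 1\<^sub>m N + X * Y) (- X) (0\<^sub>m r N) (1\<^sub>m r)"
    unfolding K_def L_def using X Y
    by (subst mult_four_block_mat[of _ N N _ r _ r]) (auto intro!: arg_cong4[where f = four_block_mat])
  then have "det (K * L) = det (c \<cdot>\<^sub>m 1\<^sub>m N + X * Y)"
    using X Y by (simp, subst det_four_block_mat_lower_left_zero) auto
  then have 1: "det K = det (c \<cdot>\<^sub>m 1\<^sub>m N + X * Y)"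
    using det_mult[OF K L] detL by simp
  have "- Y * (c \<cdot>\<^sub>m 1\<^sub>m N) + c \<cdot>\<^sub>m 1\<^sub>m r * Y = 0\<^sub>m r N"
    using Y by (simp add: mult_smult_distrib mult_smult_assoc_mat) auto
  moreover have "- Y * (- X) + c \<cdot>\<^sub>m 1\<^sub>m r * 1\<^sub>m r = c \<cdot>\<^sub>m 1\<^sub>m r + Y * X"
    using X Y by auto
  ultimately have "L' * K = four_block_mat (c \<cdot>\<^sub>m 1\<^sub>m N) (- X) (0\<^sub>m r N) (c \<cdot>\<^sub>m 1\<^sub>m r + Y * X)"
    unfolding K_def L'_def using X Y
    by (subst mult_four_block_mat[of _ N N _ r _ r]) auto
  then have "det (L' * K) = c ^ N * det (c \<cdot>\<^sub>m 1\<^sub>m r + Y * X)"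
    using X Y by (simp, subst det_four_block_mat_lower_left_zero) auto
  then show ?thesis
    using det_mult[OF L' K] detL' 1 by simp
qed

text \<open>Schur complement of the block \<open>b I\<close> with denominators cleared: the
  multiplier \<open>?L\<close> has \<open>b I\<close> where the usual one has \<open>I\<close>,
  which costs the factor \<open>b ^ k\<close> and keeps \<open>b = 0\<close> covered.\<close>

lemma det_four_block_mat_scalar_diagonal:
  fixes B C :: "'a::idom mat"
  assumes B: "B \<in> carrier_mat k n" and C: "C \<in> carrier_mat n k"
  shows "b ^ k * det (four_block_mat (a \<cdot>\<^sub>m 1\<^sub>m k) B C (b \<cdot>\<^sub>m 1\<^sub>m n))
    = b ^ n * det ((a * b) \<cdot>\<^sub>m 1\<^sub>m k - B * C)"
proof -
  let ?K = "four_block_mat (a \<cdot>\<^sub>m 1\<^sub>m k) B C (b \<cdot>\<^sub>m 1\<^sub>m n)"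
  let ?L = "four_block_mat (b \<cdot>\<^sub>m 1\<^sub>m k) (0\<^sub>m k n) (- C) (1\<^sub>m n)"
  have K: "?K \<in> carrier_mat (k + n) (k + n)" and L: "?L \<in> carrier_mat (k + n) (k + n)"
    using B C by auto
  have detL: "det ?L = b ^ k"
    using C by (subst det_four_block_mat_upper_right_zero) auto
  have "C * (b \<cdot>\<^sub>m 1\<^sub>m k) + b \<cdot>\<^sub>m 1\<^sub>m n * (- C) = 0\<^sub>m n k"
    using C by (simp add: mult_smult_distrib mult_smult_assoc_mat) auto
  moreover have "(a \<cdot>\<^sub>m 1\<^sub>m k) * (b \<cdot>\<^sub>m 1\<^sub>m k) + B * (- C) = (a * b) \<cdot>\<^sub>m 1\<^sub>m k - B * C"
    using B C by (simp add: mult_smult_distrib mult_smult_assoc_mat) auto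
  ultimately have "?K * ?L = four_block_mat ((a * b) \<cdot>\<^sub>m 1\<^sub>m k - B * C) B (0\<^sub>m n k) (b \<cdot>\<^sub>m 1\<^sub>m n)"
    using B C by (subst mult_four_block_mat[of _ k k _ n _ n]) auto
  then have "det (?K * ?L) = b ^ n * det ((a * b) \<cdot>\<^sub>m 1\<^sub>m k - B * C)"
    using B C by (simp, subst det_four_block_mat_lower_left_zero) auto
  then show ?thesis
    using det_mult[OF K L] detL by (simp add: mult.commute)
qed

section \<open>Reflections and the determinant of a product of two of them\<close>

text \<open>Orthonormal columns make \<open>P\<close> idempotent, so \<open>4 P P - 4 P\<close>
  vanishes in the square.\<close>

lemma reflection_involutive:
  fixes A :: "'a::idom mat"
  assumes A: "A \<in> carrier_mat N k" and AA: "transpose_mat A * A = 1\<^sub>m k"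
  shows "(2 \<cdot>\<^sub>m (A * transpose_mat A) - 1\<^sub>m N) * (2 \<cdot>\<^sub>m (A * transpose_mat A) - 1\<^sub>m N) = 1\<^sub>m N"
proof -
  define P where "P = A * transpose_mat A"
  have P: "P \<in> carrier_mat N N" unfolding P_def using A by auto
  have "P * P = A * (transpose_mat A * A) * transpose_mat A"
    unfolding P_def using A
    by (smt (verit) assoc_mult_mat mult_carrier_mat transpose_carrier_mat)
  then have PP: "P * P = P" unfolding AA P_def using A by simp
  have P2: "2 \<cdot>\<^sub>m P \<in> carrier_mat N N" and Q: "2 \<cdot>\<^sub>m P - 1\<^sub>m N \<in> carrier_mat N N"
    using P by auto
  have "2 \<cdot>\<^sub>m P * (2 \<cdot>\<^sub>m P) = 2 \<cdot>\<^sub>m (2 \<cdot>\<^sub>m P)"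
    using P PP by (simp add: mult_smult_distrib[OF P2 P] mult_smult_assoc_mat[OF P P])
  then have "(2 \<cdot>\<^sub>m P - 1\<^sub>m N) * (2 \<cdot>\<^sub>m P - 1\<^sub>m N) = 2 \<cdot>\<^sub>m (2 \<cdot>\<^sub>m P) - 2 \<cdot>\<^sub>m P - (2 \<cdot>\<^sub>m P - 1\<^sub>m N)"
    unfolding minus_mult_distrib_mat[OF P2 one_carrier_mat Q]
      mult_minus_distrib_mat[OF P2 P2 one_carrier_mat]
    using P by simp
  also have "\<dots> = 1\<^sub>m N" using P by auto
  finally show ?thesis unfolding P_def .
qed

text \<open>Sylvester's identity with \<open>c = - 1\<close>: on the small side,
  \<open>- I + 2 A^T A\<close> is the identity.\<close>

lemma det_reflection:
  fixes A :: "'a::idom mat"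
  assumes A: "A \<in> carrier_mat N k" and AA: "transpose_mat A * A = 1\<^sub>m k"
  shows "(- 1) ^ k * det (2 \<cdot>\<^sub>m (A * transpose_mat A) - 1\<^sub>m N) = (- 1) ^ N"
proof -
  have "(- 1) ^ k * det (- 1 \<cdot>\<^sub>m 1\<^sub>m N + (2 \<cdot>\<^sub>m A) * transpose_mat A)
      = (- 1) ^ N * det (- 1 \<cdot>\<^sub>m 1\<^sub>m k + transpose_mat A * (2 \<cdot>\<^sub>m A))"
    using A by (intro det_scalar_plus_mult_commute) auto
  moreover have "- 1 \<cdot>\<^sub>m 1\<^sub>m N + (2 \<cdot>\<^sub>m A) * transpose_mat A = 2 \<cdot>\<^sub>m (A * transpose_mat A) - 1\<^sub>m N"
    using A by auto
  moreover have "- 1 \<cdot>\<^sub>m 1\<^sub>m k + transpose_mat A * (2 \<cdot>\<^sub>m A) = 1\<^sub>m k"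
    using A AA by (simp add: mult_smult_distrib) auto
  ultimately show ?thesis by simp
qed

text \<open>Stated without quotients, so that it holds at every \<open>u\<close>, including the
  zeros of the factors on the left.\<close>

lemma det_product_of_reflections:
  fixes A B :: "'a::idom mat"
  assumes A: "A \<in> carrier_mat N k" and B: "B \<in> carrier_mat N n"
    and AA: "transpose_mat A * A = 1\<^sub>m k" and BB: "transpose_mat B * B = 1\<^sub>m n"
  shows "(1 - u) ^ (k + n) * (1 + u) ^ k *
      det (1\<^sub>m N - u \<cdot>\<^sub>m ((2 \<cdot>\<^sub>m (A * transpose_mat A) - 1\<^sub>m N) * (2 \<cdot>\<^sub>m (B * transpose_mat B) - 1\<^sub>m N)))
    = (1 - u) ^ N * (1 + u) ^ n *
      det ((1 + u)\<^sup>2 \<cdot>\<^sub>m 1\<^sub>m k - (4 * u) \<cdot>\<^sub>m (transpose_mat A * B * transpose_mat B * A))"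
proof -
  define R where "R = 2 \<cdot>\<^sub>m (A * transpose_mat A) - 1\<^sub>m N"
  define S where "S = 2 \<cdot>\<^sub>m (B * transpose_mat B) - 1\<^sub>m N"
  define C where "C = transpose_mat A * B"
  define D where "D = transpose_mat B * A"
  define E where "E = (1 + u)\<^sup>2 \<cdot>\<^sub>m 1\<^sub>m k - (4 * u) \<cdot>\<^sub>m (C * D)"
  define T where "T = (u - 1) \<cdot>\<^sub>m 1\<^sub>m N + (2 \<cdot>\<^sub>m (A * transpose_mat A) - (2 * u) \<cdot>\<^sub>m (B * transpose_mat B))"
  have R: "R \<in> carrier_mat N N" and S: "S \<in> carrier_mat N N" and T: "T \<in> carrier_mat N N"
    and C: "C \<in> carrier_mat k n" and D: "D \<in> carrier_mat n k" and E: "E \<in> carrier_mat k k"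
    unfolding R_def S_def C_def D_def T_def E_def using A B by auto
  have RR: "R * R = 1\<^sub>m N"
    unfolding R_def by (rule reflection_involutive[OF A AA])
  have detR: "(- 1) ^ k * det R = (- 1) ^ N"
    unfolding R_def by (rule det_reflection[OF A AA])
  have T_eq: "T = R - u \<cdot>\<^sub>m S"
    unfolding T_def R_def S_def using A B by (auto simp: algebra_simps)
  \<comment> \<open>Since \<open>R * R\<close> is the identity, \<open>R\<close> times
    \<open>R - u S\<close> produces the matrix in question.\<close>
  have "R * T = 1\<^sub>m N - u \<cdot>\<^sub>m (R * S)"
    unfolding T_eq using R S RR
    by (simp add: mult_minus_distrib_mat[of _ N N] mult_smult_distrib[of _ N N])
  then have det_RT: "det (1\<^sub>m N - u \<cdot>\<^sub>m (R * S)) = det R * det T"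
    using det_mult[OF R T] by simp

  \<comment> \<open>The block row and the block column are written as four-block matrices with empty
    lower or right blocks, so that the block product rule applies to both orders of
    multiplication.\<close>
  define X where "X = four_block_mat A B (0\<^sub>m 0 k) (0\<^sub>m 0 n)"
  define Y where "Y = four_block_mat (2 \<cdot>\<^sub>m transpose_mat A) (0\<^sub>m k 0)
    ((- 2 * u) \<cdot>\<^sub>m transpose_mat B) (0\<^sub>m n 0)"
  have X: "X \<in> carrier_mat N (k + n)" and Y: "Y \<in> carrier_mat (k + n) N"
    unfolding X_def Y_def carrier_mat_def using A B by auto
  have XY: "X * Y = 2 \<cdot>\<^sub>m (A * transpose_mat A) - (2 * u) \<cdot>\<^sub>m (B * transpose_mat B)"
    unfolding X_def Y_def using A B
    by (subst mult_four_block_mat[of _ N k _ n _ 0])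
      (auto simp: mult_smult_distrib[of _ N])
  have "Y * X = four_block_mat (2 \<cdot>\<^sub>m 1\<^sub>m k) (2 \<cdot>\<^sub>m C) ((- 2 * u) \<cdot>\<^sub>m D) ((- 2 * u) \<cdot>\<^sub>m 1\<^sub>m n)"
    unfolding X_def Y_def C_def D_def using A B AA BB
    by (subst mult_four_block_mat[of _ k N _ 0 _ n])
      (auto intro!: arg_cong4[where f = four_block_mat] simp: mult_smult_assoc_mat)
  \<comment> \<open>The diagonal scalars are \<open>(u - 1) + 2 = 1 + u\<close> and
    \<open>(u - 1) - 2 u = - (1 + u)\<close>.\<close>
  then have YX: "(u - 1) \<cdot>\<^sub>m 1\<^sub>m (k + n) + Y * X
      = four_block_mat ((1 + u) \<cdot>\<^sub>m 1\<^sub>m k) (2 \<cdot>\<^sub>m C) ((- 2 * u) \<cdot>\<^sub>m D) ((- (1 + u)) \<cdot>\<^sub>m 1\<^sub>m n)"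
    using C D by (auto intro!: eq_matI)
  have det_T: "(u - 1) ^ (k + n) * det T = (u - 1) ^ N *
      det (four_block_mat ((1 + u) \<cdot>\<^sub>m 1\<^sub>m k) (2 \<cdot>\<^sub>m C) ((- 2 * u) \<cdot>\<^sub>m D) ((- (1 + u)) \<cdot>\<^sub>m 1\<^sub>m n))"
    using det_scalar_plus_mult_commute[OF X Y, of "u - 1"] unfolding XY YX T_def .
  have CD: "2 \<cdot>\<^sub>m C * ((- 2 * u) \<cdot>\<^sub>m D) = (- 4 * u) \<cdot>\<^sub>m (C * D)"
    using C D by (simp add: mult_smult_distrib mult_smult_assoc_mat) auto
  have "((1 + u) * - (1 + u)) \<cdot>\<^sub>m 1\<^sub>m k - 2 \<cdot>\<^sub>m C * ((- 2 * u) \<cdot>\<^sub>m D) = (- 1) \<cdot>\<^sub>m E"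
    unfolding CD E_def using C D by (auto simp: power2_eq_square algebra_simps)
  then have det_E: "(- (1 + u)) ^ k *
      det (four_block_mat ((1 + u) \<cdot>\<^sub>m 1\<^sub>m k) (2 \<cdot>\<^sub>m C) ((- 2 * u) \<cdot>\<^sub>m D) ((- (1 + u)) \<cdot>\<^sub>m 1\<^sub>m n))
      = (- (1 + u)) ^ n * ((- 1) ^ k * det E)"
    using det_four_block_mat_scalar_diagonal[of "2 \<cdot>\<^sub>m C" k n "(- 2 * u) \<cdot>\<^sub>m D" "- (1 + u)" "1 + u"] C D E
    by simp
  define F where
    "F = det (four_block_mat ((1 + u) \<cdot>\<^sub>m 1\<^sub>m k) (2 \<cdot>\<^sub>m C) ((- 2 * u) \<cdot>\<^sub>m D) ((- (1 + u)) \<cdot>\<^sub>m 1\<^sub>m n))"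
  \<comment> \<open>Only signs remain to be settled. In the final product the exponents
    \<open>k\<close>, \<open>n\<close> and \<open>N\<close> of \<open>- 1\<close> each occur twice,
    so all signs cancel.\<close>
  have sq: "(- 1) ^ i * (- 1) ^ i = (1 :: 'a)" for i :: nat
    by (simp flip: power_mult_distrib)
  have R': "det R = (- 1) ^ k * (- 1) ^ N"
    using arg_cong[OF detR, of "\<lambda>x. (- 1) ^ k * x"] sq[of k] by (simp flip: mult.assoc)
  have "u - 1 = - (1 - u)" by simp
  then have "(- 1) ^ k * (- 1) ^ n * ((1 - u) ^ (k + n) * det T) = (- 1) ^ N * ((1 - u) ^ N * F)"
    using det_T unfolding F_def[symmetric] by (metis mult.assoc power_add power_minus)
  from arg_cong[OF this, of "\<lambda>x. (- 1) ^ k * (- 1) ^ n * x"]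
  have T': "(1 - u) ^ (k + n) * det T = (- 1) ^ k * (- 1) ^ n * (- 1) ^ N * ((1 - u) ^ N * F)"
    using sq by (simp add: mult.assoc mult.left_commute)
  have "(- 1) ^ k * ((1 + u) ^ k * F) = (- 1) ^ k * ((- 1) ^ n * ((1 + u) ^ n * det E))"
    using det_E unfolding F_def[symmetric] by (metis mult.assoc mult.left_commute power_minus)
  then have F': "(1 + u) ^ k * F = (- 1) ^ n * ((1 + u) ^ n * det E)"
    by simp
  have "(1 - u) ^ (k + n) * (1 + u) ^ k * (det R * det T)
      = det R * (1 + u) ^ k * ((1 - u) ^ (k + n) * det T)"
    by (simp add: mult_ac)
  also have "\<dots> = (- 1) ^ n * (1 - u) ^ N * ((1 + u) ^ k * F)
      * (((- 1) ^ k * (- 1) ^ k) * ((- 1) ^ N * (- 1) ^ N))"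
    unfolding T' R' by (simp only: mult_ac)
  also have "\<dots> = (1 - u) ^ N * (1 + u) ^ n * det E * ((- 1) ^ n * (- 1) ^ n)"
    unfolding sq F' by (simp add: mult_ac)
  finally have "(1 - u) ^ (k + n) * (1 + u) ^ k * (det R * det T)
      = (1 - u) ^ N * (1 + u) ^ n * det E"
    unfolding sq by simp
  moreover have "transpose_mat A * B * transpose_mat B * A = C * D"
    unfolding C_def D_def using A B by (subst assoc_mult_mat[of _ k n _ N _ k]) auto
  ultimately show ?thesis
    using det_RT unfolding R_def S_def E_def by simp
qed

section \<open>Normalized incidence matrices and continuity in \<open>u\<close>\<close>

text \<open>By the Leibniz formula the determinant is a polynomial in the entries.\<close>

lemma isCont_det:
  fixes A :: "'b::t2_space \<Rightarrow> complex mat"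
  assumes A: "\<And>x. A x \<in> carrier_mat n n"
    and cont: "\<And>i j. i < n \<Longrightarrow> j < n \<Longrightarrow> isCont (\<lambda>x. A x $$ (i, j)) a"
  shows "isCont (\<lambda>x. det (A x)) a"
proof -
  have "isCont (\<lambda>x. \<Prod>i = 0..<n. A x $$ (i, p i)) a" if "p permutes {0..<n}" for p
    using permutes_in_image[OF that] by (intro continuous_prod cont) auto
  then have "isCont (\<lambda>x. \<Sum>p | p permutes {0..<n}. signof p * (\<Prod>i = 0..<n. A x $$ (i, p i))) a"
    by (intro continuous_sum continuous_mult continuous_const) auto
  then show ?thesis
    unfolding det_def'[OF A] .
qed

text \<open>Disjoint column supports kill the off-diagonal entries. On the diagonal, entries 0 and 1
  equal their squared moduli, so the transpose needs no conjugation; nonzero columns rule out a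
  vanishing norm.\<close>

lemma normalize_cols_orthonormal:
  assumes zero_one: "\<And>i j. i < dim_row A \<Longrightarrow> j < dim_col A \<Longrightarrow> A $$ (i, j) \<in> {0, 1}"
    and disjoint: "\<And>i j j'. i < dim_row A \<Longrightarrow> j < dim_col A \<Longrightarrow> j' < dim_col A \<Longrightarrow>
      A $$ (i, j) \<noteq> 0 \<Longrightarrow> A $$ (i, j') \<noteq> 0 \<Longrightarrow> j = j'"
    and nonzero: "\<And>j. j < dim_col A \<Longrightarrow> \<exists>i < dim_row A. A $$ (i, j) \<noteq> 0"
  shows "transpose_mat (normalize_cols A) * normalize_cols A = 1\<^sub>m (dim_col A)"
proof (rule eq_matI)
  let ?B = "normalize_cols A"
  define s where "s j = (\<Sum>l<dim_row A. (cmod (A $$ (l, j)))\<^sup>2)" for j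
  fix j j' assume "j < dim_row (1\<^sub>m (dim_col A))" "j' < dim_col (1\<^sub>m (dim_col A))"
  then have j: "j < dim_col A" "j' < dim_col A" by auto
  have "(transpose_mat ?B * ?B) $$ (j, j')
      = (\<Sum>i<dim_row A. A $$ (i, j) * A $$ (i, j')
          / (complex_of_real (sqrt (s j)) * complex_of_real (sqrt (s j'))))"
    using j by (simp add: normalize_cols_def s_def scalar_prod_def lessThan_atLeast0)
  also have "\<dots> = (if j = j' then 1 else 0)"
  proof (cases "j = j'")
    case False
    then have "A $$ (i, j) * A $$ (i, j') = 0" if "i < dim_row A" for i
      using disjoint[OF that j] by auto
    then show ?thesis using False by (simp only: if_False) (intro sum.neutral, simp)
  next
    case True
    have "0 \<le> s j" by (simp add: s_def sum_nonneg)
    moreover have "s j \<noteq> 0"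
      using nonzero[OF j(1)] by (auto simp: s_def sum_nonneg_eq_0_iff)
    moreover have "(\<Sum>i<dim_row A. A $$ (i, j) * A $$ (i, j)) = complex_of_real (s j)"
      unfolding s_def of_real_sum
    proof (rule sum.cong)
      fix i assume "i \<in> {..<dim_row A}"
      with zero_one[of i j] j show "A $$ (i, j) * A $$ (i, j) = complex_of_real ((cmod (A $$ (i, j)))\<^sup>2)"
        by auto
    qed simp
    ultimately show ?thesis
      using True by (simp flip: sum_divide_distrib of_real_mult)
  qed
  finally show "(transpose_mat ?B * ?B) $$ (j, j') = 1\<^sub>m (dim_col A) $$ (j, j')"
    using j by simp
qed (simp_all add: normalize_cols_def)

lemma eventually_at_neq:
  fixes a c :: "'a::t1_space"
  shows "eventually (\<lambda>x. x \<noteq> c) (at a)"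
proof (cases "a = c")
  case True
  then show ?thesis by (simp add: eventually_at_filter)
next
  case False
  then show ?thesis by (rule tendsto_imp_eventually_ne[OF tendsto_ident_at])
qed

text \<open>Away from \<open>1\<close> and \<open>- 1\<close> the extra factors can be divided out;
  both sides are continuous at \<open>u\<close>, which settles the remaining points.\<close>

lemma det_product_of_reflections_powi:
  fixes A B :: "complex mat"
  assumes A: "A \<in> carrier_mat N k" and B: "B \<in> carrier_mat N n"
    and AA: "transpose_mat A * A = 1\<^sub>m k" and BB: "transpose_mat B * B = 1\<^sub>m n"
    and le: "n + k \<le> N" and u: "k \<le> n \<or> u \<noteq> - 1"
  shows "det (1\<^sub>m N - u \<cdot>\<^sub>m ((2 \<cdot>\<^sub>m (A * transpose_mat A) - 1\<^sub>m N) * (2 \<cdot>\<^sub>m (B * transpose_mat B) - 1\<^sub>m N)))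
    = (1 - u) powi (int N - int n - int k) * (1 + u) powi (int n - int k) *
      det ((1 + u)\<^sup>2 \<cdot>\<^sub>m 1\<^sub>m k - (4 * u) \<cdot>\<^sub>m (transpose_mat A * B * transpose_mat B * A))"
proof -
  define U where "U = (2 \<cdot>\<^sub>m (A * transpose_mat A) - 1\<^sub>m N) * (2 \<cdot>\<^sub>m (B * transpose_mat B) - 1\<^sub>m N)"
  define C where "C = transpose_mat A * B * transpose_mat B * A"
  have U: "U \<in> carrier_mat N N" and C: "C \<in> carrier_mat k k"
    unfolding U_def C_def using A B by auto
  define f where "f w = det (1\<^sub>m N - w \<cdot>\<^sub>m U)" for w
  define d where "d w = det ((1 + w)\<^sup>2 \<cdot>\<^sub>m 1\<^sub>m k - (4 * w) \<cdot>\<^sub>m C)" for w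
  define g where "g w = (1 - w) powi (int N - int n - int k) * (1 + w) powi (int n - int k) * d w" for w
  have fg: "f w = g w" if w: "w \<noteq> 1" "w \<noteq> - 1" for w
  proof -
    have nz: "1 - w \<noteq> 0" "1 + w \<noteq> 0" using w by (auto simp: add_eq_0_iff)
    have "(1 - w) ^ (k + n) * (1 + w) ^ k * f w = (1 - w) ^ N * (1 + w) ^ n * d w"
      using det_product_of_reflections[OF A B AA BB, of w] unfolding f_def d_def U_def C_def .
    then have "f w = (1 - w) ^ N / (1 - w) ^ (k + n) * ((1 + w) ^ n / (1 + w) ^ k) * d w"
      using nz by (simp add: field_simps)
    also have "(1 - w) ^ N / (1 - w) ^ (k + n) = (1 - w) powi (int N - int n - int k)"
      using nz by (simp add: power_int_diff power_add)
    also have "(1 + w) ^ n / (1 + w) ^ k = (1 + w) powi (int n - int k)"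
      using nz by (simp add: power_int_diff)
    finally show ?thesis unfolding g_def .
  qed
  have "isCont f u"
    unfolding f_def
  proof (rule isCont_det)
    show "1\<^sub>m N - w \<cdot>\<^sub>m U \<in> carrier_mat N N" for w using U by auto
    show "isCont (\<lambda>w. (1\<^sub>m N - w \<cdot>\<^sub>m U) $$ (i, j)) u" if "i < N" "j < N" for i j
      using U that by simp
  qed
  then have f: "(f \<longlongrightarrow> f u) (at u)" by (rule isContD)
  have "isCont d u"
    unfolding d_def
  proof (rule isCont_det)
    show "(1 + w)\<^sup>2 \<cdot>\<^sub>m 1\<^sub>m k - (4 * w) \<cdot>\<^sub>m C \<in> carrier_mat k k" for w using C by auto
    show "isCont (\<lambda>w. ((1 + w)\<^sup>2 \<cdot>\<^sub>m 1\<^sub>m k - (4 * w) \<cdot>\<^sub>m C) $$ (i, j)) u" if "i < k" "j < k" for i j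
      using C that by simp
  qed
  then have d: "(d \<longlongrightarrow> d u) (at u)" by (rule isContD)
  \<comment> \<open>These are the conditions for \<open>powi\<close> to be continuous: a nonzero
    base or a nonnegative exponent. At base 0 a negative exponent would give the default value
    0.\<close>
  have "1 + u \<noteq> 0 \<or> 0 \<le> int n - int k" using u by (auto simp: add_eq_0_iff)
  moreover have "0 \<le> int N - int n - int k" using le by simp
  ultimately have g: "(g \<longlongrightarrow> g u) (at u)"
    unfolding g_def by (intro tendsto_intros d) auto
  \<comment> \<open>The filter \<open>at u\<close> omits \<open>u\<close> itself, so
    \<open>u = 1\<close> and \<open>u = - 1\<close> are included.\<close>
  have "eventually (\<lambda>w. f w = g w) (at u)"
    using eventually_at_neq[of 1 u] eventually_at_neq[of "- 1" u] by eventually_elim (rule fg)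
  with f have "(g \<longlongrightarrow> f u) (at u)" by (rule Lim_transform_eventually)
  then have "f u = g u" using g by (intro tendsto_unique[OF at_neq_bot])
  then show ?thesis unfolding f_def g_def d_def U_def C_def .
qed

section \<open>Counting arcs, faces and vertices of a circular embedding\<close>

text \<open>The tail of the vertex list of a walk is the list of heads of its arcs, and a cycle does
  not repeat these.\<close>

lemma inj_on_snd_cycle_arcs:
  assumes "pre_digraph.cycle (with_proj G) p"
  shows "inj_on snd (set p)" "distinct p"
proof -
  obtain u where "pre_digraph.awalk (with_proj G) u p u"
    and d: "distinct (tl (pre_digraph.awalk_verts (with_proj G) u p))" and ne: "p \<noteq> []"
    using assms unfolding pre_digraph.cycle_def by blast
  then have "pre_digraph.cas (with_proj G) u p u"
    unfolding pre_digraph.awalk_def by blast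
  with d ne have "distinct (map snd p)"
    by (simp add: pre_digraph.awalk_verts_conv')
  then show "inj_on snd (set p)" "distinct p"
    by (simp_all add: distinct_map)
qed

locale circular_embedded_graph = pair_graph G for G :: "'a pair_pre_digraph" +
  fixes \<sigma> :: "'a \<times> 'a \<Rightarrow> 'a \<times> 'a"
  assumes connected: "Digraph_Component.connected (with_proj G)"
    and circular: "circular_embedding G \<sigma>"
begin

lemma arc_flip: "(u, v) \<in> parcs G \<Longrightarrow> (v, u) \<in> parcs G"
  using pair_sym_arcs by (auto simp: symmetric_def dest: symD)

lemma swap_in_arcs: "e \<in> parcs G \<Longrightarrow> prod.swap e \<in> parcs G"
  using arc_flip[of "fst e" "snd e"] by (simp add: prod.swap_def)

text \<open>Circularity excludes the one-vertex graph: its only face is empty, whereas a cycle has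
  arcs.\<close>

lemma arcs_nonempty: "parcs G \<noteq> {}"
proof
  assume "parcs G = {}"
  then have "{} \<in> faces G \<sigma>" by (simp add: faces_def)
  with circular have "bounded_by_cycle G {}" by (simp add: circular_embedding_def)
  then show False by (auto simp: bounded_by_cycle_def)
qed

lemma faces_eq: "faces G \<sigma> = orbit (face_next \<sigma>) ` parcs G"
  using arcs_nonempty by (simp add: faces_def)

lemma rotation_permutes: "\<sigma> permutes parcs G"
  and rotation_cyclic: "(u, v) \<in> parcs G \<Longrightarrow> cyclic_on \<sigma> {e \<in> parcs G. fst e = u}"
proof -
  have *: "rotation_system G \<sigma>" using circular by (simp add: circular_embedding_def)
  then show "\<sigma> permutes parcs G" by (simp add: rotation_system_def)
  assume "(u, v) \<in> parcs G"
  then have "u \<in> pverts G" "out_arcs (with_proj G) u \<noteq> {}"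
    using in_arcsD1 by (auto simp: out_arcs_def)
  with * have "cyclic_on \<sigma> (out_arcs (with_proj G) u)" by (simp add: rotation_system_def)
  then show "cyclic_on \<sigma> {e \<in> parcs G. fst e = u}" by (simp add: out_arcs_def)
qed

lemma face_next_bij: "bij_betw (face_next \<sigma>) (parcs G) (parcs G)"
proof -
  have "bij_betw prod.swap (parcs G) (parcs G)"
    by (rule bij_betwI[where g = prod.swap]) (simp_all only: swap_in_arcs Pi_I swap_swap)
  moreover have "bij_betw \<sigma> (parcs G) (parcs G)"
    by (rule permutes_imp_bij[OF rotation_permutes])
  ultimately have "bij_betw (\<sigma> \<circ> prod.swap) (parcs G) (parcs G)"
    by (rule bij_betw_trans)
  also have "\<sigma> \<circ> prod.swap = face_next \<sigma>"
    by (auto simp: face_next_def prod.swap_def)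
  finally show ?thesis .
qed

text \<open>
  \<open>face_next \<sigma>\<close> need not be a permutation of the whole type: outside the arcs \<open>\<sigma>\<close> is the identity,
  so \<open>face_next \<sigma>\<close> is the swap there. Restricting it makes the orbit lemmas applicable.
\<close>

lemma face_next_orbit:
  assumes "e \<in> parcs G"
  shows "cyclic_on (face_next \<sigma>) (orbit (face_next \<sigma>) e)"
    and "e \<in> orbit (face_next \<sigma>) e"
    and "orbit (face_next \<sigma>) e \<subseteq> parcs G"
proof -
  define g where "g = perm_restrict (face_next \<sigma>) (parcs G)"
  have g: "g permutes parcs G"
    unfolding g_def
    by (rule bij_imp_permutes)
      (use face_next_bij in \<open>auto simp: perm_restrict_def cong: bij_betw_cong\<close>)
  have perm: "permutation g"
    using g pair_finite_arcs permutation_permutes by blast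
  have eq: "orbit g e = orbit (face_next \<sigma>) e"
    by (rule orbit_cong0[OF assms]) (use face_next_bij in
      \<open>auto simp: g_def perm_restrict_def bij_betw_def\<close>)
  show in_orbit: "e \<in> orbit (face_next \<sigma>) e"
    using permutation_self_in_orbit[OF perm] eq by blast
  show "orbit (face_next \<sigma>) e \<subseteq> parcs G"
    using permutes_orbit_subset[OF g assms] eq by simp
  show "cyclic_on (face_next \<sigma>) (orbit (face_next \<sigma>) e)"
    using in_orbit by (auto simp: cyclic_on_def)
qed

text \<open>A cyclic orbit is generated by each of its elements; hence distinct faces are
  disjoint.\<close>

lemma face_eq_orbit:
  assumes "f \<in> faces G \<sigma>" "e \<in> f"
  shows "f = orbit (face_next \<sigma>) e"
proof -
  obtain x where "x \<in> parcs G" "f = orbit (face_next \<sigma>) x"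
    using assms(1) unfolding faces_eq by blast
  then show ?thesis
    using orbit_cyclic_eq3[OF face_next_orbit(1) assms(2)[unfolded \<open>f = _\<close>]] by simp
qed

lemma face_subset: "f \<in> faces G \<sigma> \<Longrightarrow> f \<subseteq> parcs G"
  unfolding faces_eq by (erule imageE) (simp only: face_next_orbit(3))

lemma face_inj_card:
  assumes "f \<in> faces G \<sigma>"
  shows "inj_on snd f" "3 \<le> card f"
proof -
  have "bounded_by_cycle G f" using circular assms by (simp add: circular_embedding_def)
  then obtain p where "pre_digraph.cycle (with_proj G) p" "3 \<le> length p" "set p = f"
    by (auto simp: bounded_by_cycle_def)
  then show "inj_on snd f" "3 \<le> card f"
    using inj_on_snd_cycle_arcs[of G p] by (auto simp: distinct_card)
qed

lemma faces_disjoint: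
  assumes "f \<in> faces G \<sigma>" "h \<in> faces G \<sigma>" "e \<in> f" "e \<in> h"
  shows "f = h"
  using face_eq_orbit[OF assms(1,3)] face_eq_orbit[OF assms(2,4)] by simp

text \<open>Faces are disjoint sets of at least three arcs; the factor 2 suffices for
  \<open>n + k \<le> 2 * m\<close>.\<close>

lemma two_card_faces_le: "2 * card (faces G \<sigma>) \<le> card (parcs G)"
proof -
  have "2 * card (faces G \<sigma>) = (\<Sum>f \<in> faces G \<sigma>. 2)" by simp
  also have "\<dots> \<le> (\<Sum>f \<in> faces G \<sigma>. card f)"
    by (intro sum_mono) (force dest: face_inj_card(2))
  also have "\<dots> = card (\<Union> (faces G \<sigma>))"
  proof (rule card_Union_disjoint[symmetric])
    show "disjoint (faces G \<sigma>)"
      using faces_disjoint unfolding pairwise_def disjnt_def by blast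
    show "finite f" if "f \<in> faces G \<sigma>" for f
      using face_subset[OF that] pair_finite_arcs by (rule finite_subset)
  qed
  also have "\<dots> \<le> card (parcs G)"
    using face_subset pair_finite_arcs by (intro card_mono) auto
  finally show ?thesis .
qed

text \<open>Some arc starts at a vertex \<open>a\<close>, and connectivity gives a walk from
  \<open>v\<close> to \<open>a\<close>. Either its first arc leaves \<open>v\<close>, or
  \<open>v = a\<close>.\<close>

lemma vertex_has_out_arc:
  assumes "v \<in> pverts G"
  shows "\<exists>w. (v, w) \<in> parcs G"
proof -
  obtain a b where ab: "(a, b) \<in> parcs G" using arcs_nonempty by auto
  have "strongly_connected (with_proj G)"
    by (rule symmetric_connected_imp_strongly_connected[OF pair_sym_arcs connected])
  then have "v \<rightarrow>\<^sup>*\<^bsub>with_proj G\<^esub> a"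
    using assms in_arcsD1[OF ab] by (auto simp: strongly_connected_def)
  then have "(v, a) \<in> (parcs G)\<^sup>*"
    by (auto simp: reachable_def dest: rtrancl_on_rtranclI)
  then show ?thesis
    by (cases rule: converse_rtranclE) (use ab in auto)
qed

text \<open>
  If \<open>e = (v, w)\<close> were the only arc leaving \<open>v\<close>, then the face through \<open>(w, v)\<close> would continue
  with \<open>e\<close>; as \<open>e\<close> is then the only arc of that face ending in \<open>w\<close>, the face would consist of these two arcs.
\<close>

lemma two_le_outdegree:
  assumes "v \<in> pverts G"
  shows "2 \<le> card {e \<in> parcs G. fst e = v}"
proof (rule ccontr)
  obtain w where vw: "(v, w) \<in> parcs G" using vertex_has_out_arc[OF assms] by blast
  have fin: "finite {e \<in> parcs G. fst e = v}" using pair_finite_arcs by simp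
  assume "\<not> 2 \<le> card {e \<in> parcs G. fst e = v}"
  moreover have "card {e \<in> parcs G. fst e = v} \<noteq> 0" using vw fin by auto
  ultimately have "card {e \<in> parcs G. fst e = v} = 1" by linarith
  then obtain x where x: "{e \<in> parcs G. fst e = v} = {x}" by (auto simp: card_1_singleton_iff)
  with vw have only: "{e \<in> parcs G. fst e = v} = {(v, w)}" by auto
  have "cyclic_on \<sigma> {(v, w)}" using rotation_cyclic[OF vw] only by simp
  then have "\<sigma> (v, w) = (v, w)" by (metis cyclic_on_def orbit_eq_singleton_iff singletonD)
  then have next1: "face_next \<sigma> (w, v) = (v, w)" by (simp add: face_next_def)
  define f where "f = orbit (face_next \<sigma>) (w, v)"
  have wv: "(w, v) \<in> parcs G" using arc_flip[OF vw] .
  then have f: "f \<in> faces G \<sigma>" unfolding f_def faces_eq by blast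
  have wv_f: "(w, v) \<in> f" unfolding f_def by (rule face_next_orbit(2)[OF wv])
  obtain y where y: "y \<in> f" "face_next \<sigma> y = (w, v)"
    using wv_f[unfolded f_def]
  proof cases
    case base
    then show ?thesis using that wv_f by metis
  next
    case (step y)
    show ?thesis by (rule that[OF step(2)[folded f_def] step(1)[symmetric]])
  qed
  have "y \<in> parcs G" using face_subset[OF f] y by blast
  \<comment> \<open>Rotation preserves origins, so \<open>y\<close> ends where its successor on the
    face begins.\<close>
  have "fst (\<sigma> (prod.swap y)) = snd y"
  proof -
    have yy: "(snd y, fst y) \<in> parcs G" using \<open>y \<in> parcs G\<close> arc_flip[of "fst y" "snd y"] by simp
    from cyclic_on_alldef[THEN iffD1, OF rotation_cyclic[OF yy]] yy
    have "\<sigma> (snd y, fst y) \<in> {e \<in> parcs G. fst e = snd y}"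
      by (metis (mono_tags, lifting) fst_conv mem_Collect_eq orbit.base)
    then show ?thesis by (simp add: prod.swap_def)
  qed
  then have "snd y = w" using y(2) by (simp add: face_next_def prod.swap_def)
  moreover have "(v, w) \<in> f" unfolding f_def using next1 orbit.base by metis
  ultimately have "y = (v, w)"
    using inj_onD[OF face_inj_card(1)[OF f], of y "(v, w)"] y(1) by simp
  with y(2) have next2: "face_next \<sigma> (v, w) = (w, v)" by simp
  have "z \<in> {(w, v), (v, w)}" if "z \<in> f" for z
    using that unfolding f_def by induct (use next1 next2 in auto)
  then have "card f \<le> card {(w, v), (v, w)}" by (intro card_mono) auto
  also have "\<dots> \<le> 2" using card_length[of "[(w, v), (v, w)]"] by simp
  finally show False using face_inj_card(2)[OF f] by simp
qed

lemma two_card_verts_le: "2 * card (pverts G) \<le> card (parcs G)"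
proof -
  have "2 * card (pverts G) = (\<Sum>v \<in> pverts G. 2)" by simp
  also have "\<dots> \<le> (\<Sum>v \<in> pverts G. card {e \<in> parcs G. fst e = v})"
    using two_le_outdegree by (intro sum_mono) auto
  also have "\<dots> = card (parcs G)"
    using sum.group[OF pair_finite_arcs pair_finite_verts, of fst "\<lambda>_. 1 :: nat"] arc_fst_in_verts
    by (simp add: image_subset_iff)
  finally show ?thesis .
qed

text \<open>Without loops, forgetting the direction is exactly two-to-one.\<close>

lemma card_arcs: "card (parcs G) = 2 * card (edge_set G)"
proof -
  let ?g = "\<lambda>(u, v). {u, v} :: 'a set"
  have "card {e \<in> parcs G. ?g e = x} = 2" if x: "x \<in> edge_set G" for x
  proof -
    obtain u v where uv: "(u, v) \<in> parcs G" "x = {u, v}" using x by (auto simp: edge_set_def)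
    have "e \<in> parcs G \<and> ?g e = x \<longleftrightarrow> e = (u, v) \<or> e = (v, u)" for e
    proof (cases e)
      case (Pair a b)
      show ?thesis
        unfolding uv(2) Pair using uv(1) arc_flip[OF uv(1)]
        by (simp add: doubleton_eq_iff) metis
    qed
    then have "{e \<in> parcs G. ?g e = x} = {e. e = (u, v) \<or> e = (v, u)}"
      by simp
    also have "\<dots> = {(u, v), (v, u)}"
      by auto
    finally have "{e \<in> parcs G. ?g e = x} = {(u, v), (v, u)}" .
    moreover have "u \<noteq> v" using pair_no_loops[OF uv(1)] by simp
    ultimately show ?thesis by simp
  qed
  then have "(\<Sum>x \<in> edge_set G. card {e \<in> parcs G. ?g e = x}) = 2 * card (edge_set G)"
    by simp
  moreover have "(\<Sum>x \<in> edge_set G. card {e \<in> parcs G. ?g e = x}) = card (parcs G)"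
    using sum.group[OF pair_finite_arcs, of "edge_set G" ?g "\<lambda>_. 1 :: nat"] pair_finite_arcs
    by (simp add: edge_set_def)
  ultimately show ?thesis by simp
qed
end

section \<open>The determinant of the vertex-face walk\<close>

text \<open>There may be more faces than vertices, hence the integer exponents. The last hypothesis
  excludes only the case of 0 raised to a negative power.\<close>

theorem theorem4p1:
  fixes G :: "'a pair_pre_digraph"
    and \<sigma> :: "'a \<times> 'a \<Rightarrow> 'a \<times> 'a"
    and vs :: "'a list"
    and es :: "('a \<times> 'a) list"
    and fs :: "('a \<times> 'a) set list"
    and n m k :: nat
    and Mh Nh U :: "complex mat"
    and u :: complex
  assumes "pair_graph G"
    and "Digraph_Component.connected (with_proj G)"
    and "circular_embedding G \<sigma>"
    and "enumerates vs (pverts G)"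
    and "enumerates es (parcs G)"
    and "enumerates fs (faces G \<sigma>)"
    and "n = card (pverts G)"
    and "m = card (edge_set G)"
    and "k = card (faces G \<sigma>)"
    and "Mh = normalize_cols (arc_face_mat es fs)"
    and "Nh = normalize_cols (arc_origin_mat es vs)"
    and "U = vertex_face_transition Mh Nh"
    and "k \<le> n \<or> u \<noteq> - 1"
  shows "det (1\<^sub>m (2 * m) - u \<cdot>\<^sub>m U) =
    (1 - u) powi (2 * int m - int n - int k) * (1 + u) powi (int n - int k) *
    det ((1 + u)\<^sup>2 \<cdot>\<^sub>m 1\<^sub>m k
         - (4 * u) \<cdot>\<^sub>m (transpose_mat Mh * Nh * transpose_mat Nh * Mh))"
proof -
  interpret circular_embedded_graph G \<sigma>
    using assms(1-3) by (simp add: circular_embedded_graph_def circular_embedded_graph_axioms_def)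
  have vs: "distinct vs" "set vs = pverts G" and es: "distinct es" "set es = parcs G"
    and fs: "distinct fs" "set fs = faces G \<sigma>"
    using assms(4-6) by (auto simp: enumerates_def)
  have N: "length es = 2 * m" and n: "length vs = n" and k: "length fs = k"
    using card_arcs distinct_card[OF vs(1)] distinct_card[OF es(1)] distinct_card[OF fs(1)] vs es fs assms(7-9)
    by simp_all
  have Mh: "Mh \<in> carrier_mat (2 * m) k" and Nh: "Nh \<in> carrier_mat (2 * m) n"
    unfolding assms(10,11) normalize_cols_def arc_face_mat_def arc_origin_mat_def
    using N n k by auto
  \<comment> \<open>Faces are nonempty, and no arc lies on two of them.\<close>
  have "transpose_mat Mh * Mh = 1\<^sub>m (dim_col (arc_face_mat es fs))"
    unfolding assms(10)
  proof (rule normalize_cols_orthonormal)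
    fix j assume "j < dim_col (arc_face_mat es fs)"
    then have j: "j < length fs" by (simp add: arc_face_mat_def)
    then have f: "fs ! j \<in> faces G \<sigma>" using fs nth_mem by blast
    then have "fs ! j \<noteq> {}" using face_inj_card(2) by fastforce
    then obtain e where e: "e \<in> fs ! j" by blast
    then have "e \<in> set es" using face_subset[OF f] es by blast
    then obtain i where "i < length es" "es ! i = e" by (auto simp: in_set_conv_nth)
    with e j show "\<exists>i<dim_row (arc_face_mat es fs). arc_face_mat es fs $$ (i, j) \<noteq> 0"
      by (intro exI[of _ i]) (simp add: arc_face_mat_def)
  next
    fix i j j'
    assume "i < dim_row (arc_face_mat es fs)" "j < dim_col (arc_face_mat es fs)"
      "j' < dim_col (arc_face_mat es fs)"
      "arc_face_mat es fs $$ (i, j) \<noteq> 0" "arc_face_mat es fs $$ (i, j') \<noteq> 0"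
    then have j: "j < length fs" "j' < length fs" and "es ! i \<in> fs ! j" "es ! i \<in> fs ! j'"
      by (auto simp: arc_face_mat_def split: if_splits)
    then have "fs ! j = fs ! j'" using fs(2) nth_mem by (intro faces_disjoint) auto
    then show "j = j'" using fs(1) j nth_eq_iff_index_eq by blast
  qed (simp add: arc_face_mat_def)
  then have MM: "transpose_mat Mh * Mh = 1\<^sub>m k"
    using k by (simp add: arc_face_mat_def)
  \<comment> \<open>Every vertex has an outgoing arc, and an arc has only one origin.\<close>
  have "transpose_mat Nh * Nh = 1\<^sub>m (dim_col (arc_origin_mat es vs))"
    unfolding assms(11)
  proof (rule normalize_cols_orthonormal)
    fix j assume "j < dim_col (arc_origin_mat es vs)"
    then have j: "j < length vs" by (simp add: arc_origin_mat_def)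
    then have "vs ! j \<in> pverts G" using vs nth_mem by blast
    then obtain w where "(vs ! j, w) \<in> set es" using vertex_has_out_arc es by blast
    then obtain i where "i < length es" "es ! i = (vs ! j, w)" by (auto simp: in_set_conv_nth)
    with j show "\<exists>i<dim_row (arc_origin_mat es vs). arc_origin_mat es vs $$ (i, j) \<noteq> 0"
      by (intro exI[of _ i]) (simp add: arc_origin_mat_def)
  next
    fix i j j'
    assume "i < dim_row (arc_origin_mat es vs)" "j < dim_col (arc_origin_mat es vs)"
      "j' < dim_col (arc_origin_mat es vs)"
      "arc_origin_mat es vs $$ (i, j) \<noteq> 0" "arc_origin_mat es vs $$ (i, j') \<noteq> 0"
    then have j: "j < length vs" "j' < length vs" and "vs ! j = vs ! j'"
      by (auto simp: arc_origin_mat_def split: if_splits)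
    then show "j = j'" using vs(1) nth_eq_iff_index_eq by blast
  qed (simp add: arc_origin_mat_def)
  then have NN: "transpose_mat Nh * Nh = 1\<^sub>m n"
    using n by (simp add: arc_origin_mat_def)
  \<comment> \<open>Half the sum of \<open>2 * k \<le> 2 * m\<close> and
    \<open>2 * n \<le> 2 * m\<close>.\<close>
  have le: "n + k \<le> 2 * m"
    using two_card_faces_le two_card_verts_le card_arcs assms(7-9) by simp
  have U: "U = (2 \<cdot>\<^sub>m (Mh * transpose_mat Mh) - 1\<^sub>m (2 * m)) * (2 \<cdot>\<^sub>m (Nh * transpose_mat Nh) - 1\<^sub>m (2 * m))"
    unfolding assms(12) vertex_face_transition_def using Mh Nh by simp
  show ?thesis
    unfolding U using det_product_of_reflections_powi[OF Mh Nh MM NN le assms(13)] by simp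
qed

end
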